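(* Consider all instances $\mathcal G=(m,A,\boldsymbol r,\boldsymbol\tau,u)$ of the stateless mean field game with power law discounting $u(r,t)=rt^{-\alpha}$, $\alpha\ge0$, whose sojourn-time function $\boldsymbol\tau$ is continuous and rate monotonous. Over those instances for which a stationary equilibrium exists, the price of anarchy is $2$, i.e., $$\sup\Big\{\frac{\mathrm{SW}(\boldsymbol\mu^* )}{\mathrm{SW}(\boldsymbol\mu^\dagger)}\ \Big|\ \mathcal S(\mathcal G)\ne\emptyset,\ \boldsymbol\mu^*\in\mathcal O(\mathcal G),\ \boldsymbol\mu^\dagger\in\mathcal S(\mathcal G)\Big\}=2.$$
   Context: Game data: a total mass $m>0$ of nonatomic agents; a finite action set $A=\{1,\dots,n\}$, $n\ge2$; rewards $\boldsymbol r=(r_i)_{i\in A}$, $r_i>0$; for $s>0$ put $\mathcal U_s(A)=\{\boldsymbol\mu\in\mathbb R_{\ge0}^n\mid\sum_{i\in A}\mu_i=s\}$; sojourn-time functions $\tau_i:\bigcup_{s>0}\mathcal U_s(A)\to(0,\infty)$, $\boldsymbol\tau=(\tau_i)_{i\in A}$; a utility function $u(r,t)$ (present value of reward $r$ received at time $t$). The action rates are $x_i(\boldsymbol\mu)=\mu_i/\tau_i(\boldsymbol\mu)$. Continuous and rate monotonous: $\boldsymbol\tau$ is continuous on each $\mathcal U_s(A)$, and for all $\boldsymbol\mu,\boldsymbol\mu'\in\bigcup_{s>0}\mathcal U_s(A)$ and all $i\in A$, $x_i(\boldsymbol\mu)<x_i(\boldsymbol\mu')$ implies $\tau_i(\boldsymbol\mu)\le\tau_i(\boldsymbol\mu')$.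 Strategies: $\mathcal P(A)$ is the set of probability vectors on $A$. A strategy is a sequence $\boldsymbol\sigma=(\sigma_k)_{k\ge1}\in\mathcal P(A)^{\mathbb N}$; the $k$th action $a_k$ is drawn from $\sigma_k$, independently over $k$. It is stationary if $\sigma_k$ does not depend on $k$ (then identified with an element of $\mathcal P(A)$). Optimality: given sojourn times $\boldsymbol\tau=(\tau_i)_{i\in A}$, put $\theta_k=\sum_{j=1}^k\tau_{a_j}$. - If $\alpha>1$: $\boldsymbol\sigma^*$ is optimal if it maximizes $V(\boldsymbol\sigma,\boldsymbol\tau)=\mathbb E_{\boldsymbol\sigma}\big[\sum_{k=1}^\infty r_{a_k}\theta_k^{-\alpha}\big]$ over $\boldsymbol\sigma\in\mathcal P(A)^{\mathbb N}$. - If $0\le\alpha\le1$, where the total utility diverges, strategies are compared through the leading-order growth of the total utility generated by time $T$, $V_T(\boldsymbol\sigma,\boldsymbol\tau)=\mathbb E_{\boldsymbol\sigma}\big[\sum_{k:\theta_k\le T}r_{a_k}\theta_k^{-\alpha}\big]$: $\boldsymbol\sigma^*$ is optimal if for every strategy $\boldsymbol\sigma$, $\limsup_{T\to\infty}\big(V_T(\boldsymbol\sigma,\boldsymbol\tau)-V_T(\boldsymbol\sigma^*,\boldsymbol\tau)\big)/g(T)\le0$, where $g(T)=T^{1-\alpha}$ if $\alpha<1$ and $g(T)=\log T$ if $\alpha=1$. Stationary equilibrium: a mass distribution $\boldsymbol\mu^\dagger\in\mathcal U_m(A)$ for which there is $\sigma^\dagger\in\mathcal P(A)$ such that (a) $\mu_i^\dagger=\theta\,\sigma^\dagger(i)\,\tau_i(\boldsymbol\mu^\dagger)$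 for all $i\in A$, for some normalizing constant $\theta$, and (b) the stationary strategy $\sigma^\dagger$ is optimal among all strategies for the sojourn times $\boldsymbol\tau(\boldsymbol\mu^\dagger)$. $\mathcal S(\mathcal G)$ is the set of stationary equilibria. Social welfare: $\mathrm{SW}(\boldsymbol\mu)=\sum_{i\in A}r_ix_i(\boldsymbol\mu)$, and $\mathcal O(\mathcal G)=\arg\max\{\mathrm{SW}(\boldsymbol\mu)\mid\boldsymbol\mu\in\bigcup_{0<m'\le m}\mathcal U_{m'}(A)\}$. *)

theory Defs
  imports "HOL-Probability.Probability"
begin

text \<open>
  A game is given by the total mass \<open>m\<close>, the number \<open>n\<close> of actions, the rewards, the
  sojourn-time functions (\<open>sojourn G i \<mu>\<close> is \<open>\<tau>\<^sub>i(\<mu>)\<close>), and the exponent \<open>\<alpha>\<close>, which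
  determines the utility function \<open>u(r, t) = r t\<^sup>-\<^sup>\<alpha>\<close>.
\<close>

record game =
  mass :: real
  num_actions :: nat
  reward :: "nat \<Rightarrow> real"
  sojourn :: "nat \<Rightarrow> (nat \<Rightarrow> real) \<Rightarrow> real"
  exponent :: real

definition actions :: "game \<Rightarrow> nat set" where
  "actions G = {1..num_actions G}"

definition power_law_utility :: "real \<Rightarrow> real \<Rightarrow> real \<Rightarrow> real" where
  "power_law_utility \<alpha> r t = r * t powr (- \<alpha>)"

text \<open>
  Vectors indexed by \<open>A\<close> are extensional functions, so that the product topology on
  \<^typ>\<open>nat \<Rightarrow> real\<close> restricts to the Euclidean topology.
\<close>

definition mass_distributions :: "nat set \<Rightarrow> real \<Rightarrow> (nat \<Rightarrow> real) set" where
  "mass_distributions A s = {\<mu> \<in> A \<rightarrow>\<^sub>E {0..}. (\<Sum>i\<in>A. \<mu> i) = s}"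

definition all_mass_distributions :: "nat set \<Rightarrow> (nat \<Rightarrow> real) set" where
  "all_mass_distributions A = (\<Union>s\<in>{0<..}. mass_distributions A s)"

definition power_law_game :: "game \<Rightarrow> bool" where
  "power_law_game G \<longleftrightarrow>
     mass G > 0 \<and> num_actions G \<ge> 2 \<and> exponent G \<ge> 0 \<and>
     (\<forall>i\<in>actions G. reward G i > 0) \<and>
     (\<forall>i\<in>actions G. \<forall>\<mu>\<in>all_mass_distributions (actions G). sojourn G i \<mu> > 0)"

definition action_rate :: "game \<Rightarrow> nat \<Rightarrow> (nat \<Rightarrow> real) \<Rightarrow> real" where
  "action_rate G i \<mu> = \<mu> i / sojourn G i \<mu>"

definition continuous_sojourn :: "game \<Rightarrow> bool" where
  "continuous_sojourn G \<longleftrightarrow>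
     (\<forall>s>0. \<forall>i\<in>actions G. continuous_on (mass_distributions (actions G) s) (sojourn G i))"

definition rate_monotonous :: "game \<Rightarrow> bool" where
  "rate_monotonous G \<longleftrightarrow>
     (\<forall>\<mu>\<in>all_mass_distributions (actions G). \<forall>\<mu>'\<in>all_mass_distributions (actions G).
        \<forall>i\<in>actions G. action_rate G i \<mu> < action_rate G i \<mu>' \<longrightarrow> sojourn G i \<mu> \<le> sojourn G i \<mu>')"

text \<open>
  Strategies, action sequences and completion times are indexed from \<open>0\<close>: \<open>\<sigma> k\<close>, \<open>a k\<close> and
  \<open>completion_time \<tau> a k\<close> are the mathematical \<open>\<sigma>\<^sub>k\<^sub>+\<^sub>1\<close>, \<open>a\<^sub>k\<^sub>+\<^sub>1\<close> and \<open>\<theta>\<^sub>k\<^sub>+\<^sub>1\<close>.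
\<close>

definition strategies :: "nat set \<Rightarrow> (nat \<Rightarrow> nat pmf) set" where
  "strategies A = {\<sigma>. \<forall>k. set_pmf (\<sigma> k) \<subseteq> A}"

definition action_process :: "(nat \<Rightarrow> nat pmf) \<Rightarrow> (nat \<Rightarrow> nat) measure" where
  "action_process \<sigma> = (\<Pi>\<^sub>M k\<in>UNIV. measure_pmf (\<sigma> k))"

definition completion_time :: "(nat \<Rightarrow> real) \<Rightarrow> (nat \<Rightarrow> nat) \<Rightarrow> nat \<Rightarrow> real" where
  "completion_time \<tau> a k = (\<Sum>j\<le>k. \<tau> (a j))"

definition total_utility ::
    "real \<Rightarrow> (nat \<Rightarrow> real) \<Rightarrow> (nat \<Rightarrow> real) \<Rightarrow> (nat \<Rightarrow> nat pmf) \<Rightarrow> real" where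
  "total_utility \<alpha> r \<tau> \<sigma> =
     (\<integral>a. (\<Sum>k. power_law_utility \<alpha> (r (a k)) (completion_time \<tau> a k)) \<partial>action_process \<sigma>)"

text \<open>
  The series below is almost surely a finite sum: the sojourn times of the finitely many
  actions have a positive lower bound.
\<close>

definition total_utility_until ::
    "real \<Rightarrow> (nat \<Rightarrow> real) \<Rightarrow> (nat \<Rightarrow> real) \<Rightarrow> real \<Rightarrow> (nat \<Rightarrow> nat pmf) \<Rightarrow> real" where
  "total_utility_until \<alpha> r \<tau> T \<sigma> =
     (\<integral>a. (\<Sum>k. if completion_time \<tau> a k \<le> T
               then power_law_utility \<alpha> (r (a k)) (completion_time \<tau> a k) else 0)
        \<partial>action_process \<sigma>)"

definition growth_scale :: "real \<Rightarrow> real \<Rightarrow> real" where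
  "growth_scale \<alpha> T = (if \<alpha> < 1 then T powr (1 - \<alpha>) else ln T)"

definition optimal_strategy ::
    "nat set \<Rightarrow> real \<Rightarrow> (nat \<Rightarrow> real) \<Rightarrow> (nat \<Rightarrow> real) \<Rightarrow> (nat \<Rightarrow> nat pmf) \<Rightarrow> bool" where
  "optimal_strategy A \<alpha> r \<tau> \<sigma>' \<longleftrightarrow> \<sigma>' \<in> strategies A \<and>
     (if \<alpha> > 1
      then \<forall>\<sigma>\<in>strategies A. total_utility \<alpha> r \<tau> \<sigma> \<le> total_utility \<alpha> r \<tau> \<sigma>'
      else \<forall>\<sigma>\<in>strategies A.
             Limsup at_top (\<lambda>T. ereal
               ((total_utility_until \<alpha> r \<tau> T \<sigma> - total_utility_until \<alpha> r \<tau> T \<sigma>')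
                 / growth_scale \<alpha> T)) \<le> 0)"

definition stationary_equilibria :: "game \<Rightarrow> (nat \<Rightarrow> real) set" where
  "stationary_equilibria G =
     {\<mu> \<in> mass_distributions (actions G) (mass G).
        \<exists>p :: nat pmf. set_pmf p \<subseteq> actions G \<and>
          (\<exists>\<theta>. \<forall>i\<in>actions G. \<mu> i = \<theta> * pmf p i * sojourn G i \<mu>) \<and>
          optimal_strategy (actions G) (exponent G) (reward G) (\<lambda>i. sojourn G i \<mu>) (\<lambda>k. p)}"

definition social_welfare :: "game \<Rightarrow> (nat \<Rightarrow> real) \<Rightarrow> real" where
  "social_welfare G \<mu> = (\<Sum>i\<in>actions G. reward G i * action_rate G i \<mu>)"

definition social_optima :: "game \<Rightarrow> (nat \<Rightarrow> real) set" where
  "social_optima G =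
     {\<mu>. is_arg_max (social_welfare G)
           (\<lambda>\<nu>. \<nu> \<in> (\<Union>m'\<in>{0<..mass G}. mass_distributions (actions G) m')) \<mu>}"

end

theory Submission
  imports Defs
begin

text \<open>
  A stationary optimal strategy plays only actions that maximize the reward per unit of time
  \<open>r\<^sub>i / \<tau>\<^sub>i\<close>, whatever \<open>\<alpha>\<close> is. Indeed \<open>\<Sum> \<tau>\<^bsub>a\<^sub>k\<^esub> \<theta>\<^sub>k\<^sup>-\<^sup>\<alpha>\<close> is a Riemann sum of \<open>\<integral> t\<^sup>-\<^sup>\<alpha> dt\<close>, so the utility along any path
  is at most \<open>\<rho> = max r\<^sub>i / \<tau>\<^sub>i\<close> times this integral, up to a bounded error, minus a loss for every
  inferior action played. For \<open>\<alpha> \<le> 1\<close> the expected losses of a strategy that plays an inferior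
  action with positive probability grow like the integral itself. For \<open>\<alpha> > 1\<close>, switching for good to
  a best action after \<open>M\<close> stages avoids losses of order \<open>M\<^sup>1\<^sup>-\<^sup>\<alpha>\<close> at the cost of an error of order
  \<open>M\<^sup>-\<^sup>\<alpha>\<close>. Hence equilibrium welfare equals \<open>\<rho> m\<close>, which rate monotonicity compares with the optimum.
\<close>

subsection \<open>Action processes\<close>

lemma prob_space_action_process: "prob_space (action_process \<sigma>)"
  unfolding action_process_def by (intro prob_space_PiM prob_space_measure_pmf)

lemma space_action_process [simp]: "space (action_process \<sigma>) = UNIV"
  by (simp add: action_process_def space_PiM)

lemma sets_action_process: "sets (action_process \<sigma>) = sets (\<Pi>\<^sub>M k\<in>UNIV. count_space UNIV)"
  unfolding action_process_def by (intro sets_PiM_cong) auto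

lemma measurable_action_process [measurable]:
  "(\<lambda>a. a k) \<in> action_process \<sigma> \<rightarrow>\<^sub>M count_space UNIV"
  by (subst measurable_cong_sets[OF sets_action_process refl]) simp

lemma borel_measurable_action [measurable]:
  "(\<lambda>a. (f :: nat \<Rightarrow> real) (a k)) \<in> borel_measurable (action_process \<sigma>)"
  by (rule measurable_compose[OF measurable_action_process]) simp

lemma borel_measurable_completion_time [measurable]:
  "(\<lambda>a. completion_time \<tau> a k) \<in> borel_measurable (action_process \<sigma>)"
  unfolding completion_time_def by measurable

text \<open>The estimates below concern paths inside \<open>A\<close>. Countably many null events
  are discarded here, so that they pass to expectations.\<close>

lemma AE_action_process:
  assumes "\<sigma> \<in> strategies A"
  shows "AE a in action_process \<sigma>. \<forall>k. a k \<in> A"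
proof -
  have "AE a in action_process \<sigma>. a k \<in> A" for k
    unfolding action_process_def
    using assms by (intro AE_PiM_component prob_space_measure_pmf)
      (auto simp: strategies_def AE_measure_pmf_iff)
  then show ?thesis
    by (simp add: AE_all_countable)
qed

text \<open>Losses are charged as deterministic amounts on the events \<open>a k = i\<close>, so
  their expectation involves only the marginal of stage \<open>k\<close>.\<close>

lemma expectation_action_indicator:
  "integrable (action_process \<sigma>) (\<lambda>a. if a k = i then c else 0 :: real)"
  "(\<integral>a. (if a k = i then c else 0 :: real) \<partial>action_process \<sigma>) = pmf (\<sigma> k) i * c"
proof -
  interpret prob_space "action_process \<sigma>" by (rule prob_space_action_process)
  show "integrable (action_process \<sigma>) (\<lambda>a. if a k = i then c else 0 :: real)"
    by (intro integrable_const_bound[where B = "\<bar>c\<bar>"]) auto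
  have "(\<integral>a. (if a k = i then c else 0 :: real) \<partial>action_process \<sigma>) =
      (\<integral>b. (if b = i then c else 0) \<partial>distr (action_process \<sigma>) (measure_pmf (\<sigma> k)) (\<lambda>a. a k))"
    unfolding action_process_def
    by (intro integral_distr[symmetric] measurable_component_singleton) auto
  also have "distr (action_process \<sigma>) (measure_pmf (\<sigma> k)) (\<lambda>a. a k) = measure_pmf (\<sigma> k)"
    unfolding action_process_def by (intro distr_PiM_component prob_space_measure_pmf) auto
  also have "(\<integral>b. (if b = i then c else 0) \<partial>measure_pmf (\<sigma> k)) = (\<Sum>b\<in>{i}. pmf (\<sigma> k) b *\<^sub>R c)"
    by (subst integral_measure_pmf[of "{i}"]) (auto split: if_splits)
  finally show "(\<integral>a. (if a k = i then c else 0 :: real) \<partial>action_process \<sigma>) = pmf (\<sigma> k) i * c"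
    by simp
qed

text \<open>A coupling: a strategy altered stage by stage can be evaluated on the same random path
  as the original one. Product measures are determined by their values on cylinder sets.\<close>

lemma action_process_map:
  "action_process (\<lambda>k. map_pmf (f k) (\<sigma> k)) =
     distr (action_process \<sigma>) (action_process (\<lambda>k. map_pmf (f k) (\<sigma> k))) (\<lambda>a k. f k (a k))"
    (is "?P = ?D")
proof -
  let ?M = "\<lambda>k. measure_pmf (map_pmf (f k) (\<sigma> k))"
  interpret product_prob_space ?M UNIV
    by unfold_locales
  have meas: "(\<lambda>a k. f k (a k)) \<in> action_process \<sigma> \<rightarrow>\<^sub>M ?P"
  proof (subst measurable_cong_sets[OF refl sets_action_process], rule measurable_PiM_single')
    show "(\<lambda>a. f k (a k)) \<in> action_process \<sigma> \<rightarrow>\<^sub>M count_space UNIV" for k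
      by (rule measurable_compose[OF measurable_action_process]) simp
  qed auto
  have "?D = Pi\<^sub>M UNIV ?M"
  proof (rule PiM_eq)
    show "sets ?D = sets (Pi\<^sub>M UNIV ?M)"
      by (simp add: action_process_def)
  next
    fix J :: "nat set" and F :: "nat \<Rightarrow> nat set"
    assume J: "finite J" "J \<subseteq> UNIV"
    let ?X = "prod_emb UNIV ?M J (\<Pi>\<^sub>E j\<in>J. F j)"
    have "?X \<in> sets ?P"
      unfolding action_process_def by (rule sets_PiM_I[OF J]) auto
    then have "emeasure ?D ?X = emeasure (action_process \<sigma>) ((\<lambda>a k. f k (a k)) -` ?X)"
      by (subst emeasure_distr[OF meas]) auto
    also have "(\<lambda>a k. f k (a k)) -` ?X =
        prod_emb UNIV (\<lambda>k. measure_pmf (\<sigma> k)) J (\<Pi>\<^sub>E j\<in>J. f j -` F j)"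
      by (auto simp: prod_emb_def PiE_iff)
    also have "emeasure (action_process \<sigma>) \<dots> = (\<Prod>j\<in>J. emeasure (measure_pmf (\<sigma> j)) (f j -` F j))"
      unfolding action_process_def
      using J by (intro Infinite_Product_Measure.emeasure_PiM_emb prob_space_measure_pmf) auto
    finally show "emeasure ?D ?X = (\<Prod>j\<in>J. emeasure (?M j) (F j))"
      by simp
  qed
  then show ?thesis
    by (simp add: action_process_def)
qed

subsection \<open>Comparison of discounted sums with the antiderivative of the discount function\<close>

text \<open>The additive constant of this antiderivative is chosen to serve both regimes: for
  \<alpha> \<le> 1 it is an exact multiple of \<open>growth_scale\<close>, and for \<alpha> > 1 it
  vanishes at infinity.\<close>

definition discount_integral :: "real \<Rightarrow> real \<Rightarrow> real" where
  "discount_integral \<alpha> t = (if \<alpha> = 1 then ln t else t powr (1 - \<alpha>) / (1 - \<alpha>))"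

lemma discount_integral_has_derivative:
  "t > 0 \<Longrightarrow> (discount_integral \<alpha> has_real_derivative t powr (- \<alpha>)) (at t)"
  unfolding discount_integral_def
  by (cases "\<alpha> = 1")
    (auto intro!: derivative_eq_intros simp: powr_minus divide_inverse)

text \<open>By the mean value theorem the increment is the length of the interval times the discount
  at an intermediate point, and the discount function is decreasing.\<close>

lemma discount_integral_bounds:
  assumes "\<alpha> \<ge> 0" "0 < s" "s \<le> t"
  shows "(t - s) * t powr (- \<alpha>) \<le> discount_integral \<alpha> t - discount_integral \<alpha> s"
    and "discount_integral \<alpha> t - discount_integral \<alpha> s \<le> (t - s) * s powr (- \<alpha>)"
proof -
  have "\<exists>z. s \<le> z \<and> z \<le> t \<and>
      discount_integral \<alpha> t - discount_integral \<alpha> s = (t - s) * z powr (- \<alpha>)"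
  proof (cases "s = t")
    case False
    with assms have "s < t" by simp
    then obtain z where "s < z" "z < t"
      "discount_integral \<alpha> t - discount_integral \<alpha> s = (t - s) * z powr (- \<alpha>)"
      using MVT2[of s t "discount_integral \<alpha>" "\<lambda>z. z powr (- \<alpha>)"]
        discount_integral_has_derivative assms by force
    then show ?thesis by (intro exI[of _ z]) auto
  qed auto
  then obtain z where z: "s \<le> z" "z \<le> t"
    "discount_integral \<alpha> t - discount_integral \<alpha> s = (t - s) * z powr (- \<alpha>)"
    by blast
  have "t powr (- \<alpha>) \<le> z powr (- \<alpha>)" "z powr (- \<alpha>) \<le> s powr (- \<alpha>)"
    using assms z by (auto intro!: powr_mono2')
  then show "(t - s) * t powr (- \<alpha>) \<le> discount_integral \<alpha> t - discount_integral \<alpha> s"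
    and "discount_integral \<alpha> t - discount_integral \<alpha> s \<le> (t - s) * s powr (- \<alpha>)"
    using assms z by (auto intro!: mult_left_mono)
qed

lemma discount_integral_mono:
  "0 < s \<Longrightarrow> s \<le> t \<Longrightarrow> \<alpha> \<ge> 0 \<Longrightarrow> discount_integral \<alpha> s \<le> discount_integral \<alpha> t"
  by (rule diff_ge_0_iff_ge[THEN iffD1], rule order_trans[OF _ discount_integral_bounds(1)]) auto

text \<open>A left endpoint Riemann sum of a decreasing function dominates its integral.\<close>

lemma sum_discounts_ge:
  assumes "\<alpha> \<ge> 0" "0 < s" "0 < t"
  shows "discount_integral \<alpha> (t + real n * s) - discount_integral \<alpha> t \<le>
           (\<Sum>k<n. s * (t + real k * s) powr (- \<alpha>))"
proof (induction n)
  case (Suc n)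
  have "discount_integral \<alpha> (t + real (Suc n) * s) - discount_integral \<alpha> (t + real n * s) \<le>
      s * (t + real n * s) powr (- \<alpha>)"
    using discount_integral_bounds(2)[of \<alpha> "t + real n * s" "t + real (Suc n) * s"] assms
    by (simp add: algebra_simps add_pos_nonneg)
  with Suc show ?case by simp
qed simp

lemma discount_integral_growth:
  assumes "0 \<le> \<alpha>" "\<alpha> \<le> 1"
  shows "\<exists>c>0. \<forall>T>0. discount_integral \<alpha> T = c * growth_scale \<alpha> T"
  using assms
  by (intro exI[of _ "if \<alpha> = 1 then 1 else 1 / (1 - \<alpha>)"])
    (auto simp: discount_integral_def growth_scale_def)

lemma growth_scale_at_top: "\<alpha> \<le> 1 \<Longrightarrow> filterlim (growth_scale \<alpha>) at_top at_top"
proof (cases "\<alpha> < 1")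
  case True
  have "((\<lambda>T. T powr (\<alpha> - 1)) \<longlongrightarrow> 0) at_top"
    using True by (intro tendsto_neg_powr filterlim_ident) auto
  then have "filterlim (\<lambda>T. inverse (T powr (\<alpha> - 1))) at_top at_top"
    by (intro filterlim_inverse_at_top) (auto intro: eventually_mono[OF eventually_gt_at_top[of 0]])
  moreover have "growth_scale \<alpha> = (\<lambda>T. inverse (T powr (\<alpha> - 1)))"
    using True by (auto simp: growth_scale_def fun_eq_iff simp flip: powr_minus)
  ultimately show ?thesis by simp
qed (simp add: growth_scale_def[abs_def] ln_at_top)

subsection \<open>Paths\<close>

text \<open>The sojourn times are frozen at one mass distribution: optimality of a strategy depends
  only on the numbers \<tau> i, not on the game.\<close>

locale action_data =
  fixes A :: "nat set" and r \<tau> :: "nat \<Rightarrow> real" and \<alpha> :: real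
  assumes finite_A: "finite A" and nonempty_A: "A \<noteq> {}"
    and reward_pos: "i \<in> A \<Longrightarrow> r i > 0"
    and sojourn_pos: "i \<in> A \<Longrightarrow> \<tau> i > 0"
    and exponent_nonneg: "\<alpha> \<ge> 0"
begin

definition "min_sojourn = Min (\<tau> ` A)"
definition "max_sojourn = Max (\<tau> ` A)"
definition "max_reward = Max (r ` A)"
definition "max_rate = Max ((\<lambda>i. r i / \<tau> i) ` A)"

lemma min_sojourn: "min_sojourn > 0" "i \<in> A \<Longrightarrow> min_sojourn \<le> \<tau> i"
  using finite_A nonempty_A sojourn_pos by (auto simp: min_sojourn_def)

lemma max_sojourn: "max_sojourn > 0" "i \<in> A \<Longrightarrow> \<tau> i \<le> max_sojourn"
  using finite_A nonempty_A sojourn_pos by (auto simp: max_sojourn_def Max_gr_iff)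

lemma max_reward: "max_reward > 0" "i \<in> A \<Longrightarrow> r i \<le> max_reward"
  using finite_A nonempty_A reward_pos by (auto simp: max_reward_def Max_gr_iff)

lemma max_rate: "max_rate > 0" "i \<in> A \<Longrightarrow> r i \<le> max_rate * \<tau> i"
proof -
  show "max_rate > 0"
    using finite_A nonempty_A reward_pos sojourn_pos
    by (auto simp: max_rate_def Max_gr_iff)
  show "r i \<le> max_rate * \<tau> i" if "i \<in> A"
  proof -
    have "r i / \<tau> i \<le> max_rate"
      unfolding max_rate_def using finite_A that by (intro Max_ge) auto
    with sojourn_pos[OF that] show ?thesis by (simp add: pos_divide_le_eq)
  qed
qed

lemma max_rate_attained: obtains j where "j \<in> A" "r j = max_rate * \<tau> j"
proof -
  have "max_rate \<in> (\<lambda>i. r i / \<tau> i) ` A"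
    unfolding max_rate_def using finite_A nonempty_A by (intro Max_in) auto
  then obtain j where "j \<in> A" "max_rate = r j / \<tau> j" by blast
  with sojourn_pos[of j] show ?thesis by (intro that[of j]) auto
qed

abbreviation "\<theta> \<equiv> completion_time \<tau>"
abbreviation "stage_utility a k \<equiv> power_law_utility \<alpha> (r (a k)) (\<theta> a k)"

lemma completion_time_0 [simp]: "\<theta> a 0 = \<tau> (a 0)"
  by (simp add: completion_time_def)

lemma completion_time_Suc: "\<theta> a (Suc k) = \<theta> a k + \<tau> (a (Suc k))"
  by (simp add: completion_time_def)

lemma completion_time_const: "\<theta> (\<lambda>_. j) k = (real k + 1) * \<tau> j"
  by (simp add: completion_time_def algebra_simps)

context
  fixes a :: "nat \<Rightarrow> nat"
  assumes a: "\<And>k. a k \<in> A"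
begin

lemma completion_time_ge: "(real k + 1) * min_sojourn \<le> \<theta> a k"
  using sum_mono[of "{..k}" "\<lambda>_. min_sojourn" "\<lambda>j. \<tau> (a j)"] min_sojourn(2)[OF a]
  by (simp add: completion_time_def algebra_simps)

lemma completion_time_le: "\<theta> a k \<le> (real k + 1) * max_sojourn"
  using sum_mono[of "{..k}" "\<lambda>j. \<tau> (a j)" "\<lambda>_. max_sojourn"] max_sojourn(2)[OF a]
  by (simp add: completion_time_def algebra_simps)

lemma completion_time_pos: "\<theta> a k > 0"
  using completion_time_ge[of k] min_sojourn(1) mult_pos_pos[of "real k + 1" min_sojourn] by linarith

lemma completion_time_mono: "k \<le> l \<Longrightarrow> \<theta> a k \<le> \<theta> a l"
  unfolding completion_time_def
  using a sojourn_pos by (intro sum_mono2) (auto intro: less_imp_le)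

text \<open>Rewards are discounted at the completion of a stage, the right endpoint, so each term
  lies below the integral over its stage and the bounds telescope. The very first stage is excluded,
  as the integral from time 0 diverges for \<alpha> \<ge> 1.\<close>

lemma sum_sojourn_discount_le:
  "(\<Sum>k<n. \<tau> (a (Suc (M + k))) * \<theta> a (Suc (M + k)) powr (- \<alpha>)) \<le>
     discount_integral \<alpha> (\<theta> a (M + n)) - discount_integral \<alpha> (\<theta> a M)"
proof (induction n)
  case (Suc n)
  have "\<tau> (a (Suc (M + n))) * \<theta> a (Suc (M + n)) powr (- \<alpha>) \<le>
      discount_integral \<alpha> (\<theta> a (Suc (M + n))) - discount_integral \<alpha> (\<theta> a (M + n))"
    using discount_integral_bounds(1)[OF exponent_nonneg completion_time_pos[of "M + n"],
        of "\<theta> a (Suc (M + n))"] sojourn_pos[OF a, of "Suc (M + n)"]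
    by (simp add: completion_time_Suc)
  with Suc show ?case by simp
qed simp

lemma stage_utility_nonneg: "stage_utility a k \<ge> 0"
  using reward_pos[OF a, of k] by (simp add: power_law_utility_def)

lemma stage_utility_le: "stage_utility a k \<le> max_reward * ((real k + 1) * min_sojourn) powr (- \<alpha>)"
  unfolding power_law_utility_def
  using a max_reward min_sojourn(1) completion_time_ge[of k] exponent_nonneg reward_pos[OF a, of k]
  by (intro mult_mono powr_mono2') auto

text \<open>Playing \<open>i\<close> falls short of \<open>max_rate\<close> by the stated factor
  times the discount at the completion time. Replacing that time by its worst case makes the loss
  depend on the path only through the event \<open>a k = i\<close>.\<close>

lemma stage_utility_plus_loss_le:
  assumes "i \<in> A"
  shows "stage_utility a k +
      (if a k = i then (max_rate * \<tau> i - r i) * ((real k + 1) * max_sojourn) powr (- \<alpha>) else 0) \<le>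
    max_rate * (\<tau> (a k) * \<theta> a k powr (- \<alpha>))"
proof (cases "a k = i")
  case True
  have "(max_rate * \<tau> i - r i) * ((real k + 1) * max_sojourn) powr (- \<alpha>) \<le>
      (max_rate * \<tau> i - r i) * \<theta> a k powr (- \<alpha>)"
    using max_rate(2)[OF assms] completion_time_le[of k] completion_time_pos[of k] exponent_nonneg
    by (intro mult_left_mono powr_mono2') auto
  with True show ?thesis by (simp add: power_law_utility_def algebra_simps)
next
  case False
  have "r (a k) * \<theta> a k powr (- \<alpha>) \<le> max_rate * \<tau> (a k) * \<theta> a k powr (- \<alpha>)"
    using max_rate(2)[OF a, of k] by (intro mult_right_mono) auto
  with False show ?thesis by (simp add: power_law_utility_def)
qed


text \<open>Completion times increase and grow at least linearly, so the stages completed by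
  \<open>T\<close> form a finite initial segment. It contains the first stage because
  \<open>T\<close> is at least \<open>max_sojourn\<close>.\<close>

lemma sum_until:
  assumes "T \<ge> max_sojourn"
  obtains n where "n > 0" "\<And>k. \<theta> a k \<le> T \<longleftrightarrow> k < n"
    "(\<Sum>k. if \<theta> a k \<le> T then stage_utility a k else 0) = (\<Sum>k<n. stage_utility a k)"
proof -
  obtain N where "T / min_sojourn < real N"
    using reals_Archimedean2 by blast
  then have "T < real N * min_sojourn"
    using min_sojourn(1) by (simp add: pos_divide_less_eq)
  also have "\<dots> \<le> \<theta> a N"
    using completion_time_ge[of N] min_sojourn(1) by (simp add: algebra_simps)
  finally have N: "T < \<theta> a N" .
  define n where "n = (LEAST k. T < \<theta> a k)"
  have n: "T < \<theta> a n"
    unfolding n_def using N by (rule LeastI)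
  have iff: "\<theta> a k \<le> T \<longleftrightarrow> k < n" for k
    using completion_time_mono[of n k] n not_less_Least[of k "\<lambda>k. T < \<theta> a k"]
    by (auto simp: n_def not_less[symmetric] dest: less_le_trans)
  have "\<theta> a 0 \<le> T"
    using max_sojourn(2)[OF a, of 0] assms by simp
  then have "n > 0" unfolding iff .
  moreover have "(\<Sum>k. if \<theta> a k \<le> T then stage_utility a k else 0) =
      (\<Sum>k<n. if \<theta> a k \<le> T then stage_utility a k else 0)"
    by (intro suminf_finite) (auto simp: iff)
  ultimately show ?thesis
    by (intro that[of n]) (auto simp: iff)
qed

lemma sum_until_nonneg:
  "T \<ge> max_sojourn \<Longrightarrow> 0 \<le> (\<Sum>k. if \<theta> a k \<le> T then stage_utility a k else 0)"
  by (erule sum_until) (auto intro: sum_nonneg stage_utility_nonneg)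

text \<open>The first stage is bounded crudely, the later ones by the integral up to
  \<open>T\<close>. Only losses of the first \<open>K\<close> stages are charged, since these are
  completed by \<open>T\<close> on every path; this keeps the loss sum free of random
  limits.\<close>

lemma sum_until_plus_loss_le:
  assumes "i \<in> A" "T \<ge> max_sojourn" "real K * max_sojourn \<le> T"
  shows "(\<Sum>k. if \<theta> a k \<le> T then stage_utility a k else 0) +
      (\<Sum>k<K. if a k = i then (max_rate * \<tau> i - r i) * ((real k + 1) * max_sojourn) powr (- \<alpha>) else 0)
    \<le> max_rate * (discount_integral \<alpha> T +
        (max_sojourn * min_sojourn powr (- \<alpha>) - discount_integral \<alpha> min_sojourn))"
proof -
  let ?l = "\<lambda>k. if a k = i then (max_rate * \<tau> i - r i) * ((real k + 1) * max_sojourn) powr (- \<alpha>) else 0"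
  obtain n where n: "n > 0" "\<And>k. \<theta> a k \<le> T \<longleftrightarrow> k < n"
    "(\<Sum>k. if \<theta> a k \<le> T then stage_utility a k else 0) = (\<Sum>k<n. stage_utility a k)"
    using sum_until[OF assms(2)] by blast
  obtain m where m: "n = Suc m"
    using n(1) gr0_conv_Suc by blast
  have "K \<le> n"
  proof (cases K)
    case (Suc k)
    then have "\<theta> a k \<le> T"
      using completion_time_le[of k] assms(3) by (simp add: algebra_simps)
    with n(2) Suc show ?thesis by simp
  qed simp
  then have "(\<Sum>k<K. ?l k) \<le> (\<Sum>k<n. ?l k)"
    using max_rate(2)[OF assms(1)] by (intro sum_mono2) auto
  then have "(\<Sum>k<n. stage_utility a k) + (\<Sum>k<K. ?l k) \<le> (\<Sum>k<n. stage_utility a k + ?l k)"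
    by (simp add: sum.distrib)
  also have "\<dots> \<le> (\<Sum>k<n. max_rate * (\<tau> (a k) * \<theta> a k powr (- \<alpha>)))"
    by (intro sum_mono stage_utility_plus_loss_le assms)
  also have "\<dots> = max_rate * (\<tau> (a 0) * \<tau> (a 0) powr (- \<alpha>) +
      (\<Sum>k<m. \<tau> (a (Suc k)) * \<theta> a (Suc k) powr (- \<alpha>)))"
    unfolding m by (subst sum.lessThan_Suc_shift) (simp add: sum_distrib_left algebra_simps)
  also have "\<dots> \<le> max_rate * (discount_integral \<alpha> T +
        (max_sojourn * min_sojourn powr (- \<alpha>) - discount_integral \<alpha> min_sojourn))"
  proof (rule mult_left_mono)
    have "(\<Sum>k<m. \<tau> (a (Suc k)) * \<theta> a (Suc k) powr (- \<alpha>)) \<le>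
        discount_integral \<alpha> (\<theta> a m) - discount_integral \<alpha> (\<tau> (a 0))"
      using sum_sojourn_discount_le[where M = 0 and n = m] by simp
    moreover have "discount_integral \<alpha> (\<theta> a m) \<le> discount_integral \<alpha> T"
      using n(2)[of m] m completion_time_pos exponent_nonneg by (intro discount_integral_mono) auto
    moreover have "discount_integral \<alpha> min_sojourn \<le> discount_integral \<alpha> (\<tau> (a 0))"
      using min_sojourn a exponent_nonneg by (intro discount_integral_mono) auto
    moreover have "\<tau> (a 0) * \<tau> (a 0) powr (- \<alpha>) \<le> max_sojourn * min_sojourn powr (- \<alpha>)"
      using min_sojourn max_sojourn a exponent_nonneg by (intro mult_mono powr_mono2') auto
    ultimately show "\<tau> (a 0) * \<tau> (a 0) powr (- \<alpha>) +
        (\<Sum>k<m. \<tau> (a (Suc k)) * \<theta> a (Suc k) powr (- \<alpha>)) \<le>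
      discount_integral \<alpha> T +
        (max_sojourn * min_sojourn powr (- \<alpha>) - discount_integral \<alpha> min_sojourn)"
      by linarith
  qed (use max_rate(1) in auto)
  finally show ?thesis
    by (simp add: n(3))
qed

end

subsection \<open>Weak discounting\<close>

lemma borel_measurable_sum_until [measurable]:
  "(\<lambda>a. \<Sum>k. if \<theta> a k \<le> T then stage_utility a k else 0) \<in> borel_measurable (action_process \<sigma>)"
  unfolding power_law_utility_def by measurable

lemma total_utility_until_plus_loss_le:
  assumes \<sigma>: "\<sigma> \<in> strategies A" and i: "i \<in> A"
    and T: "T \<ge> max_sojourn" "real K * max_sojourn \<le> T"
  shows "total_utility_until \<alpha> r \<tau> T \<sigma> +
      (\<Sum>k<K. pmf (\<sigma> k) i * ((max_rate * \<tau> i - r i) * ((real k + 1) * max_sojourn) powr (- \<alpha>)))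
    \<le> max_rate * (discount_integral \<alpha> T +
        (max_sojourn * min_sojourn powr (- \<alpha>) - discount_integral \<alpha> min_sojourn))"
    (is "_ + (\<Sum>k<K. pmf (\<sigma> k) i * ?L k) \<le> ?B")
proof -
  interpret prob_space "action_process \<sigma>" by (rule prob_space_action_process)
  let ?U = "\<lambda>a. \<Sum>k. if \<theta> a k \<le> T then stage_utility a k else 0"
  let ?l = "\<lambda>a k. if a k = i then ?L k else 0"
  \<comment> \<open>The pathwise bound with \<open>K = 0\<close> bounds the utility by a
    constant.\<close>
  have int: "integrable (action_process \<sigma>) ?U"
  proof (rule integrable_const_bound)
    show "AE a in action_process \<sigma>. norm (?U a) \<le> ?B"
      using AE_action_process[OF \<sigma>]
    proof eventually_elim
      case (elim a)
      then show ?case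
        using sum_until_plus_loss_le[of a i T 0] sum_until_nonneg[of a T] i T max_sojourn(1)
        by simp
    qed
  qed measurable
  have "total_utility_until \<alpha> r \<tau> T \<sigma> + (\<Sum>k<K. pmf (\<sigma> k) i * ?L k) =
      (\<integral>a. ?U a + (\<Sum>k<K. ?l a k) \<partial>action_process \<sigma>)"
    unfolding total_utility_until_def
    by (subst Bochner_Integration.integral_add)
      (auto simp: int expectation_action_indicator intro!: Bochner_Integration.integrable_sum)
  also have "\<dots> \<le> ?B"
  proof (rule integral_le_const)
    show "integrable (action_process \<sigma>) (\<lambda>a. ?U a + (\<Sum>k<K. ?l a k))"
      by (intro Bochner_Integration.integrable_add int Bochner_Integration.integrable_sum
          expectation_action_indicator)
    show "AE a in action_process \<sigma>. ?U a + (\<Sum>k<K. ?l a k) \<le> ?B"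
      using AE_action_process[OF \<sigma>]
      by eventually_elim (use sum_until_plus_loss_le i T in auto)
  qed
  finally show ?thesis .
qed

text \<open>Under a constant strategy the completion times are the equally spaced left endpoints of
  a Riemann sum that extends beyond \<open>T\<close>.\<close>

lemma total_utility_until_const_ge:
  assumes j: "j \<in> A" "r j = max_rate * \<tau> j" and T: "T \<ge> max_sojourn"
  shows "max_rate * (discount_integral \<alpha> T - discount_integral \<alpha> (\<tau> j)) \<le>
    total_utility_until \<alpha> r \<tau> T (\<lambda>_. return_pmf j)"
proof -
  let ?P = "action_process (\<lambda>_. return_pmf j)"
  let ?U = "\<lambda>a. \<Sum>k. if \<theta> a k \<le> T then stage_utility a k else 0"
  interpret prob_space ?P by (rule prob_space_action_process)
  \<comment> \<open>The constant strategy is a strategy over the one-element action set, so almost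
    every path is constant.\<close>
  have "AE a in ?P. a = (\<lambda>_. j)"
    using AE_action_process[of "\<lambda>_. return_pmf j" "{j}"]
    by (auto simp: strategies_def)
  then have "total_utility_until \<alpha> r \<tau> T (\<lambda>_. return_pmf j) = (\<integral>a. ?U (\<lambda>_. j) \<partial>?P)"
    unfolding total_utility_until_def by (intro integral_cong_AE) auto
  then have U: "total_utility_until \<alpha> r \<tau> T (\<lambda>_. return_pmf j) = ?U (\<lambda>_. j)"
    using prob_space by (simp del: space_action_process)
  obtain n where n: "\<And>k. \<theta> (\<lambda>_. j) k \<le> T \<longleftrightarrow> k < n"
    "?U (\<lambda>_. j) = (\<Sum>k<n. stage_utility (\<lambda>_. j) k)"
    using sum_until[of "\<lambda>_. j" T] j T by blast
  \<comment> \<open>Counting from 0, stage \<open>n\<close> is the first one not completed by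
    \<open>T\<close>, and its completion time is the right end of the Riemann sum.\<close>
  have "T < \<tau> j + real n * \<tau> j"
    using n(1)[of n] by (simp add: completion_time_const algebra_simps)
  then have "discount_integral \<alpha> T - discount_integral \<alpha> (\<tau> j) \<le>
      discount_integral \<alpha> (\<tau> j + real n * \<tau> j) - discount_integral \<alpha> (\<tau> j)"
    using T max_sojourn(1) exponent_nonneg by (simp add: discount_integral_mono)
  also have "\<dots> \<le> (\<Sum>k<n. \<tau> j * (\<tau> j + real k * \<tau> j) powr (- \<alpha>))"
    using sojourn_pos[OF j(1)] exponent_nonneg by (intro sum_discounts_ge)
  finally have "max_rate * (discount_integral \<alpha> T - discount_integral \<alpha> (\<tau> j)) \<le>
      max_rate * (\<Sum>k<n. \<tau> j * (\<tau> j + real k * \<tau> j) powr (- \<alpha>))"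
    using max_rate(1) by (intro mult_left_mono) auto
  also have "\<dots> = (\<Sum>k<n. stage_utility (\<lambda>_. j) k)"
    by (simp add: power_law_utility_def completion_time_const j(2) sum_distrib_left
        algebra_simps)
  finally show ?thesis by (simp only: U n(2))
qed

lemma tendsto_divide_growth_scale:
  "\<alpha> \<le> 1 \<Longrightarrow> ((\<lambda>T. D / growth_scale \<alpha> T) \<longlongrightarrow> 0) at_top"
  by (intro real_tendsto_divide_at_top[OF tendsto_const] growth_scale_at_top)

lemma eventually_growth_scale_pos: "\<alpha> \<le> 1 \<Longrightarrow> eventually (\<lambda>T. growth_scale \<alpha> T > 0) at_top"
  using growth_scale_at_top filterlim_at_top_dense by blast

text \<open>The upper bound for an arbitrary strategy and the lower bound for the constant one
  differ by a constant independent of \<open>T\<close>, which the growth scale absorbs. This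
  supplies the equilibrium in the lower bound example.\<close>

lemma optimal_const:
  assumes "\<alpha> \<le> 1" and j: "j \<in> A" "r j = max_rate * \<tau> j"
  shows "optimal_strategy A \<alpha> r \<tau> (\<lambda>_. return_pmf j)"
proof -
  have "Limsup at_top (\<lambda>T. ereal ((total_utility_until \<alpha> r \<tau> T \<sigma> -
      total_utility_until \<alpha> r \<tau> T (\<lambda>_. return_pmf j)) / growth_scale \<alpha> T)) \<le> 0"
    if \<sigma>: "\<sigma> \<in> strategies A" for \<sigma>
  proof -
    define D where "D = max_rate * (max_sojourn * min_sojourn powr (- \<alpha>) -
      discount_integral \<alpha> min_sojourn + discount_integral \<alpha> (\<tau> j))"
    have "eventually (\<lambda>T. ereal ((total_utility_until \<alpha> r \<tau> T \<sigma> -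
        total_utility_until \<alpha> r \<tau> T (\<lambda>_. return_pmf j)) / growth_scale \<alpha> T) \<le>
        ereal (D / growth_scale \<alpha> T)) at_top"
      using eventually_growth_scale_pos[OF assms(1)] eventually_ge_at_top[of max_sojourn]
    proof eventually_elim
      case (elim T)
      have "total_utility_until \<alpha> r \<tau> T \<sigma> - total_utility_until \<alpha> r \<tau> T (\<lambda>_. return_pmf j) \<le> D"
        using total_utility_until_plus_loss_le[OF \<sigma> j(1), of T 0]
          total_utility_until_const_ge[OF j, of T] elim max_sojourn(1)
        by (simp add: D_def algebra_simps)
      with elim show ?case by (auto intro: divide_right_mono)
    qed
    then have "Limsup at_top (\<lambda>T. ereal ((total_utility_until \<alpha> r \<tau> T \<sigma> -
        total_utility_until \<alpha> r \<tau> T (\<lambda>_. return_pmf j)) / growth_scale \<alpha> T)) \<le>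
        Limsup at_top (\<lambda>T. ereal (D / growth_scale \<alpha> T))"
      by (rule Limsup_mono)
    also have "\<dots> = ereal 0"
      by (intro lim_imp_Limsup tendsto_intros tendsto_divide_growth_scale assms) simp
    finally show ?thesis by (simp add: zero_ereal_def)
  qed
  with assms show ?thesis
    by (auto simp: optimal_strategy_def strategies_def)
qed

lemma stationary_optimal_weak:
  assumes "\<alpha> \<le> 1" and opt: "optimal_strategy A \<alpha> r \<tau> (\<lambda>_. p)" and i: "i \<in> set_pmf p"
  shows "r i = max_rate * \<tau> i"
proof (rule ccontr)
  assume "r i \<noteq> max_rate * \<tau> i"
  have p: "(\<lambda>_. p) \<in> strategies A"
    using opt by (auto simp: optimal_strategy_def)
  with i have "i \<in> A" by (auto simp: strategies_def)
  define d where "d = max_rate * \<tau> i - r i"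
  have "d > 0"
    using max_rate(2)[OF \<open>i \<in> A\<close>] \<open>r i \<noteq> _\<close> by (simp add: d_def)
  obtain j where j: "j \<in> A" "r j = max_rate * \<tau> j"
    by (rule max_rate_attained)
  obtain c where c: "c > 0" "\<And>T. T > 0 \<Longrightarrow> discount_integral \<alpha> T = c * growth_scale \<alpha> T"
    using discount_integral_growth[OF exponent_nonneg assms(1)] by blast
  \<comment> \<open>Expected loss per stage divided by the mesh: the loss sum becomes
    \<open>e\<close> times a Riemann sum with mesh \<open>max_sojourn\<close>.\<close>
  define e where "e = pmf p i * d / max_sojourn"
  have "e > 0"
    using i \<open>d > 0\<close> max_sojourn(1) by (simp add: e_def pmf_positive)
  \<comment> \<open>All terms that do not depend on \<open>T\<close>: the errors of both utility
    bounds and the lower end of the integral bounding the losses.\<close>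
  define D where "D = max_rate * (max_sojourn * min_sojourn powr (- \<alpha>) -
    discount_integral \<alpha> min_sojourn + discount_integral \<alpha> (\<tau> j)) + e * discount_integral \<alpha> max_sojourn"
  have "eventually (\<lambda>T. ereal (e * c - D / growth_scale \<alpha> T) \<le>
      ereal ((total_utility_until \<alpha> r \<tau> T (\<lambda>_. return_pmf j) -
        total_utility_until \<alpha> r \<tau> T (\<lambda>_. p)) / growth_scale \<alpha> T)) at_top"
    using eventually_growth_scale_pos[OF assms(1)] eventually_ge_at_top[of max_sojourn]
  proof eventually_elim
    case (elim T)
    \<comment> \<open>The number of stages certain to be completed by \<open>T\<close>; with one
      more \<open>max_sojourn\<close> they cover \<open>T\<close>, so their losses grow like the
      whole integral.\<close>
    define K where "K = nat \<lfloor>T / max_sojourn\<rfloor>"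
    have "T > 0" using elim max_sojourn(1) by simp
    then have "real K \<le> T / max_sojourn" "T / max_sojourn < real K + 1"
      using max_sojourn(1) by (auto simp: K_def intro: of_nat_floor)
    then have K: "real K * max_sojourn \<le> T" "T \<le> max_sojourn + real K * max_sojourn"
      using max_sojourn(1) by (auto simp: field_simps)
    have "e * (discount_integral \<alpha> T - discount_integral \<alpha> max_sojourn) \<le>
        e * (discount_integral \<alpha> (max_sojourn + real K * max_sojourn) -
          discount_integral \<alpha> max_sojourn)"
      using K \<open>T > 0\<close> \<open>e > 0\<close> exponent_nonneg
      by (intro mult_left_mono diff_right_mono discount_integral_mono) auto
    also have "\<dots> \<le> e * (\<Sum>k<K. max_sojourn * (max_sojourn + real k * max_sojourn) powr (- \<alpha>))"
      using \<open>e > 0\<close> max_sojourn(1) exponent_nonneg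
      by (intro mult_left_mono sum_discounts_ge) auto
    also have "\<dots> = (\<Sum>k<K. pmf p i * (d * ((real k + 1) * max_sojourn) powr (- \<alpha>)))"
      using max_sojourn(1) by (simp add: e_def sum_distrib_left algebra_simps)
    finally have "e * (discount_integral \<alpha> T - discount_integral \<alpha> max_sojourn) \<le>
        (\<Sum>k<K. pmf p i * (d * ((real k + 1) * max_sojourn) powr (- \<alpha>)))" .
    then have "e * discount_integral \<alpha> T - D \<le>
        total_utility_until \<alpha> r \<tau> T (\<lambda>_. return_pmf j) - total_utility_until \<alpha> r \<tau> T (\<lambda>_. p)"
      using total_utility_until_plus_loss_le[OF p \<open>i \<in> A\<close> elim(2) K(1)]
        total_utility_until_const_ge[OF j elim(2)]
      by (simp add: D_def d_def algebra_simps)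
    then have "(e * (c * growth_scale \<alpha> T) - D) / growth_scale \<alpha> T \<le>
        (total_utility_until \<alpha> r \<tau> T (\<lambda>_. return_pmf j) - total_utility_until \<alpha> r \<tau> T (\<lambda>_. p))
          / growth_scale \<alpha> T"
      using elim(1) by (intro divide_right_mono) (auto simp: c(2) \<open>T > 0\<close>)
    with elim(1) show ?case by (simp add: diff_divide_distrib)
  qed
  then have "Limsup at_top (\<lambda>T. ereal (e * c - D / growth_scale \<alpha> T)) \<le>
      Limsup at_top (\<lambda>T. ereal ((total_utility_until \<alpha> r \<tau> T (\<lambda>_. return_pmf j) -
        total_utility_until \<alpha> r \<tau> T (\<lambda>_. p)) / growth_scale \<alpha> T))"
    by (rule Limsup_mono)
  also have "\<dots> \<le> 0"
  proof -
    have "(\<lambda>_. return_pmf j) \<in> strategies A"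
      using j by (auto simp: strategies_def)
    with opt assms(1) show ?thesis by (auto simp: optimal_strategy_def)
  qed
  finally have "Limsup at_top (\<lambda>T. ereal (e * c - D / growth_scale \<alpha> T)) \<le> 0" .
  moreover have "((\<lambda>T. e * c - D / growth_scale \<alpha> T) \<longlongrightarrow> e * c - 0) at_top"
    by (intro tendsto_intros tendsto_divide_growth_scale assms)
  then have "Limsup at_top (\<lambda>T. ereal (e * c - D / growth_scale \<alpha> T)) = ereal (e * c)"
    by (intro lim_imp_Limsup) auto
  ultimately have "e * c \<le> 0" by simp
  with \<open>e > 0\<close> c(1) show False
    by (simp add: mult_le_0_iff)
qed


subsection \<open>Strong discounting\<close>

context
  assumes strong: "\<alpha> > 1"
begin

text \<open>For positive \<open>t\<close>, minus this value is the convergent integral of the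
  discount function from \<open>t\<close> to infinity.\<close>

lemma discount_integral_nonpos: "discount_integral \<alpha> t \<le> 0"
  using strong by (simp add: discount_integral_def divide_nonneg_neg)

lemma discount_integral_tendsto_0:
  assumes "s > 0"
  shows "(\<lambda>n. discount_integral \<alpha> (t + real n * s)) \<longlonglongrightarrow> 0"
proof -
  have "filterlim (\<lambda>n. t + real n * s) at_top sequentially"
    using assms by (intro filterlim_tendsto_add_at_top[OF tendsto_const]
        filterlim_at_top_mult_tendsto_pos[OF tendsto_const _ filterlim_real_sequentially])
  then have "(\<lambda>n. (t + real n * s) powr (1 - \<alpha>) / (1 - \<alpha>)) \<longlonglongrightarrow> 0 / (1 - \<alpha>)"
    using strong by (intro tendsto_divide tendsto_neg_powr tendsto_const) auto
  with strong show ?thesis by (simp add: discount_integral_def)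
qed

lemma summable_discounts:
  assumes "s > 0"
  shows "summable (\<lambda>k. ((real k + 1) * s) powr (- \<alpha>))"
proof -
  have "summable (\<lambda>k. real (Suc k) powr (- \<alpha>))"
    using strong by (subst summable_Suc_iff) (simp add: summable_real_powr_iff)
  then have "summable (\<lambda>k. real (Suc k) powr (- \<alpha>) * s powr (- \<alpha>))"
    by (rule summable_mult2)
  with assms show ?thesis by (simp add: powr_mult add.commute)
qed

lemma summable_stage_utility:
  assumes "\<And>k. a k \<in> A"
  shows "summable (stage_utility a)"
proof (rule summable_comparison_test')
  show "summable (\<lambda>k. max_reward * ((real k + 1) * min_sojourn) powr (- \<alpha>))"
    by (intro summable_mult summable_discounts min_sojourn)
  show "norm (stage_utility a k) \<le> max_reward * ((real k + 1) * min_sojourn) powr (- \<alpha>)" for k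
    using stage_utility_nonneg[of a k] stage_utility_le[of a k] assms by simp
qed

lemma integrable_sum_stage_utility:
  assumes "\<sigma> \<in> strategies A"
  shows "integrable (action_process \<sigma>) (\<lambda>a. \<Sum>k. stage_utility a k)"
proof -
  interpret prob_space "action_process \<sigma>" by (rule prob_space_action_process)
  let ?B = "\<Sum>k. max_reward * ((real k + 1) * min_sojourn) powr (- \<alpha>)"
  show ?thesis
  proof (rule integrable_const_bound)
    show "AE a in action_process \<sigma>. norm (\<Sum>k. stage_utility a k) \<le> ?B"
      using AE_action_process[OF assms]
    proof eventually_elim
      case (elim a)
      then have a: "\<And>k. a k \<in> A" by blast
      have "(\<Sum>k. stage_utility a k) \<le> ?B"
        by (intro suminf_le stage_utility_le a summable_stage_utility summable_mult
            summable_discounts min_sojourn)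
      moreover have "(\<Sum>k. stage_utility a k) \<ge> 0"
        by (intro suminf_nonneg summable_stage_utility stage_utility_nonneg a)
      ultimately show ?case by simp
    qed
    show "(\<lambda>a. \<Sum>k. stage_utility a k) \<in> borel_measurable (action_process \<sigma>)"
      unfolding power_law_utility_def by measurable
  qed
qed

text \<open>Both paths agree up to stage \<open>M\<close>. Afterwards the old one earns at most
  \<open>max_rate\<close> times the tail integral from \<theta> a M, minus its losses; the new one
  earns at least \<open>max_rate\<close> times the tail integral from \<theta> a M + \<tau> j. The
  switch thus costs at most the integral over one sojourn of \<open>j\<close>.\<close>

lemma suminf_stage_utility_switch:
  assumes a: "\<And>k. a k \<in> A" and i: "i \<in> A" and j: "j \<in> A" "r j = max_rate * \<tau> j"
  shows "(\<Sum>k. stage_utility a k) + (\<Sum>k<n. if a (Suc (M + k)) = i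
        then (max_rate * \<tau> i - r i) * ((real (Suc (M + k)) + 1) * max_sojourn) powr (- \<alpha>) else 0)
      - max_rate * \<tau> j * ((real M + 1) * min_sojourn) powr (- \<alpha>)
    \<le> (\<Sum>k. stage_utility (\<lambda>k. if k \<le> M then a k else j) k)"
proof -
  let ?l = "\<lambda>k. if a (Suc (M + k)) = i
    then (max_rate * \<tau> i - r i) * ((real (Suc (M + k)) + 1) * max_sojourn) powr (- \<alpha>) else 0"
  define b where "b = (\<lambda>k. if k \<le> M then a k else j)"
  have b: "\<And>k. b k \<in> A" using a j by (simp add: b_def)
  have \<theta>_b: "\<theta> b k = \<theta> a k" if "k \<le> M" for k
    using that by (auto simp: completion_time_def b_def intro!: sum.cong)
  have \<theta>_b': "\<theta> b (Suc (M + k)) = \<theta> a M + \<tau> j + real k * \<tau> j" for k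
  proof (induction k)
    case 0
    show ?case by (simp add: completion_time_Suc \<theta>_b) (simp add: b_def)
  next
    case (Suc k)
    have "b (Suc (M + Suc k)) = j" by (simp add: b_def)
    with Suc show ?case
      by (simp add: completion_time_Suc[of b "Suc (M + k)"] algebra_simps)
  qed
  have split: "(\<Sum>k. stage_utility c k) =
      (\<Sum>k. stage_utility c (Suc (M + k))) + (\<Sum>k\<le>M. stage_utility c k)"
    if "\<And>k. c k \<in> A" for c
    using suminf_split_initial_segment[OF summable_stage_utility[of c], of "Suc M"] that
    by (simp add: lessThan_Suc_atMost add.commute)
  have tail: "summable (\<lambda>k. stage_utility c (Suc (M + k)))" if "\<And>k. c k \<in> A" for c
    using summable_ignore_initial_segment[OF summable_stage_utility[of c], of "Suc M"] that
    by (simp add: add.commute)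
  have init: "(\<Sum>k\<le>M. stage_utility b k) = (\<Sum>k\<le>M. stage_utility a k)"
    by (intro sum.cong) (simp_all add: \<theta>_b, simp add: b_def)
  \<comment> \<open>The bound is uniform in \<open>m\<close>, hence passes to the infinite
    sum.\<close>
  have "(\<Sum>k<m. stage_utility a (Suc (M + k))) \<le>
      - max_rate * discount_integral \<alpha> (\<theta> a M) - (\<Sum>k<n. ?l k)" if "m \<ge> n" for m
  proof -
    have "(\<Sum>k<n. ?l k) \<le> (\<Sum>k<m. ?l k)"
      using max_rate(2)[OF i] that by (intro sum_mono2) auto
    then have "(\<Sum>k<m. stage_utility a (Suc (M + k))) + (\<Sum>k<n. ?l k) \<le>
        (\<Sum>k<m. stage_utility a (Suc (M + k)) + ?l k)"
      by (simp add: sum.distrib)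
    also have "\<dots> \<le> (\<Sum>k<m. max_rate *
        (\<tau> (a (Suc (M + k))) * \<theta> a (Suc (M + k)) powr (- \<alpha>)))"
      by (intro sum_mono stage_utility_plus_loss_le a i)
    also have "\<dots> \<le> max_rate * (discount_integral \<alpha> (\<theta> a (M + m)) - discount_integral \<alpha> (\<theta> a M))"
      unfolding sum_distrib_left[symmetric]
      using max_rate(1) by (intro mult_left_mono sum_sojourn_discount_le a) auto
    also have "\<dots> \<le> max_rate * (0 - discount_integral \<alpha> (\<theta> a M))"
      using max_rate(1) by (intro mult_left_mono diff_right_mono discount_integral_nonpos) auto
    finally show ?thesis by simp
  qed
  then have upper: "(\<Sum>k. stage_utility a (Suc (M + k))) \<le>
      - max_rate * discount_integral \<alpha> (\<theta> a M) - (\<Sum>k<n. ?l k)"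
    by (intro LIMSEQ_le_const2[OF summable_LIMSEQ[OF tail[of a, OF a]]]) blast
  have "(\<lambda>m. max_rate * (discount_integral \<alpha> (\<theta> a M + \<tau> j + real m * \<tau> j) -
      discount_integral \<alpha> (\<theta> a M + \<tau> j))) \<longlonglongrightarrow>
    max_rate * (0 - discount_integral \<alpha> (\<theta> a M + \<tau> j))"
    by (intro tendsto_intros discount_integral_tendsto_0 sojourn_pos j)
  then have lower: "max_rate * (0 - discount_integral \<alpha> (\<theta> a M + \<tau> j)) \<le>
      (\<Sum>k. stage_utility b (Suc (M + k)))"
  proof (rule LIMSEQ_le[OF _ summable_LIMSEQ[OF tail[of b, OF b]]], intro exI allI impI)
    fix m
    have "max_rate * (discount_integral \<alpha> (\<theta> a M + \<tau> j + real m * \<tau> j) -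
        discount_integral \<alpha> (\<theta> a M + \<tau> j)) \<le>
      max_rate * (\<Sum>k<m. \<tau> j * (\<theta> a M + \<tau> j + real k * \<tau> j) powr (- \<alpha>))"
      using max_rate(1) sojourn_pos[OF j(1)] completion_time_pos[of a M, OF a] exponent_nonneg
      by (intro mult_left_mono sum_discounts_ge) (auto intro: add_pos_pos)
    also have "\<dots> = (\<Sum>k<m. stage_utility b (Suc (M + k)))"
      unfolding power_law_utility_def \<theta>_b'
      by (simp add: b_def j(2) sum_distrib_left mult.assoc)
    finally show "max_rate * (discount_integral \<alpha> (\<theta> a M + \<tau> j + real m * \<tau> j) -
        discount_integral \<alpha> (\<theta> a M + \<tau> j)) \<le> (\<Sum>k<m. stage_utility b (Suc (M + k)))" .
  qed
  \<comment> \<open>The gap between the two tail integrals.\<close>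
  have "discount_integral \<alpha> (\<theta> a M + \<tau> j) - discount_integral \<alpha> (\<theta> a M) \<le>
      \<tau> j * \<theta> a M powr (- \<alpha>)"
    using discount_integral_bounds(2)[OF exponent_nonneg completion_time_pos[of a M, OF a],
        of "\<theta> a M + \<tau> j"] sojourn_pos[OF j(1)] by simp
  also have "\<dots> \<le> \<tau> j * ((real M + 1) * min_sojourn) powr (- \<alpha>)"
    using completion_time_ge[of a M, OF a] min_sojourn(1) sojourn_pos[OF j(1)] exponent_nonneg
    by (intro mult_left_mono powr_mono2') auto
  finally have "max_rate * (discount_integral \<alpha> (\<theta> a M + \<tau> j) - discount_integral \<alpha> (\<theta> a M)) \<le>
      max_rate * (\<tau> j * ((real M + 1) * min_sojourn) powr (- \<alpha>))"
    using max_rate(1) by (intro mult_left_mono) auto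
  then have "(\<Sum>k. stage_utility a k) + (\<Sum>k<n. ?l k)
      - max_rate * \<tau> j * ((real M + 1) * min_sojourn) powr (- \<alpha>) \<le> (\<Sum>k. stage_utility b k)"
    using upper lower split[of a, OF a] split[of b, OF b] init
    by (simp add: algebra_simps)
  then show ?thesis
    by (simp only: b_def)
qed

lemma stationary_optimal_strong:
  assumes opt: "optimal_strategy A \<alpha> r \<tau> (\<lambda>_. p)" and i: "i \<in> set_pmf p"
  shows "r i = max_rate * \<tau> i"
proof (rule ccontr)
  assume "r i \<noteq> max_rate * \<tau> i"
  have p: "(\<lambda>_. p) \<in> strategies A"
    using opt by (auto simp: optimal_strategy_def)
  with i have "i \<in> A" by (auto simp: strategies_def)
  define d where "d = max_rate * \<tau> i - r i"
  have "d > 0"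
    using max_rate(2)[OF \<open>i \<in> A\<close>] \<open>r i \<noteq> _\<close> by (simp add: d_def)
  obtain j where j: "j \<in> A" "r j = max_rate * \<tau> j"
    by (rule max_rate_attained)
  \<comment> \<open>The stages \<open>M + 1\<close> to \<open>2 * M + 1\<close> each lose at least
    \<open>(real M + 1) powr (- \<alpha>) * e\<close> in expectation, while switching costs at most
    \<open>(real M + 1) powr (- \<alpha>) * C\<close>. With \<open>M + 1\<close> such stages, a
    large \<open>M\<close> makes the switch profitable.\<close>
  define e where "e = pmf p i * d * (2 * max_sojourn) powr (- \<alpha>)"
  have "e > 0"
    using i \<open>d > 0\<close> max_sojourn(1) by (simp add: e_def pmf_positive)
  define C where "C = max_rate * \<tau> j * min_sojourn powr (- \<alpha>)"
  obtain M where "C / e < real M"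
    using reals_Archimedean2 by blast
  with \<open>e > 0\<close> have M: "C < (real M + 1) * e"
    by (simp add: pos_divide_less_eq algebra_simps)
  define f where "f = (\<lambda>k l. if k \<le> M then l else j)"
  define \<sigma> where "\<sigma> = (\<lambda>k. map_pmf (f k) p)"
  have \<sigma>: "\<sigma> \<in> strategies A"
    using p j by (auto simp: strategies_def \<sigma>_def f_def)
  interpret prob_space "action_process (\<lambda>_. p)" by (rule prob_space_action_process)
  let ?U = "\<lambda>a. \<Sum>k. stage_utility a k"
  let ?L = "\<lambda>k. d * ((real (Suc (M + k)) + 1) * max_sojourn) powr (- \<alpha>)"
  let ?l = "\<lambda>a k. if a (Suc (M + k)) = i then ?L k else 0"
  have meas_U: "?U \<in> borel_measurable (action_process \<sigma>)"
    using integrable_sum_stage_utility[OF \<sigma>] by simp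
  have meas_f: "(\<lambda>a k. f k (a k)) \<in> action_process (\<lambda>_. p) \<rightarrow>\<^sub>M action_process \<sigma>"
  proof (subst measurable_cong_sets[OF refl sets_action_process], rule measurable_PiM_single')
    show "(\<lambda>a. f k (a k)) \<in> action_process (\<lambda>_. p) \<rightarrow>\<^sub>M count_space UNIV" for k
      by (rule measurable_compose[OF measurable_action_process]) simp
  qed auto
  have distr: "action_process \<sigma> =
      distr (action_process (\<lambda>_. p)) (action_process \<sigma>) (\<lambda>a k. f k (a k))"
    unfolding \<sigma>_def by (rule action_process_map)
  have int_f: "integrable (action_process (\<lambda>_. p)) (\<lambda>a. ?U (\<lambda>k. f k (a k)))"
    using integrable_sum_stage_utility[OF \<sigma>] integrable_distr_eq[OF meas_f meas_U]
    unfolding distr[symmetric] by simp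
  have "(real M + 1) powr (- \<alpha>) * C < (real M + 1) powr (- \<alpha>) * ((real M + 1) * e)"
    using M by (intro mult_strict_left_mono) auto
  also have "\<dots> = (\<Sum>k<Suc M. pmf p i * (d * ((2 * (real M + 1)) * max_sojourn) powr (- \<alpha>)))"
  proof -
    have "((2 * (real M + 1)) * max_sojourn) powr (- \<alpha>) =
        (real M + 1) powr (- \<alpha>) * (2 * max_sojourn) powr (- \<alpha>)"
      by (subst powr_mult[symmetric]) (rule arg_cong[where f = "\<lambda>x. x powr _"], simp)
    then show ?thesis by (simp add: e_def algebra_simps)
  qed
  \<comment> \<open>For \<open>k\<close> at most \<open>M\<close> the factor
    \<open>real (Suc (M + k)) + 1\<close> is at most \<open>2 * (real M + 1)\<close>.\<close>
  also have "\<dots> \<le> (\<Sum>k<Suc M. pmf p i * ?L k)"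
    using \<open>d > 0\<close> max_sojourn(1) exponent_nonneg
    by (intro sum_mono mult_left_mono powr_mono2') auto
  finally have "total_utility \<alpha> r \<tau> (\<lambda>_. p) < total_utility \<alpha> r \<tau> (\<lambda>_. p) +
      (\<Sum>k<Suc M. pmf p i * ?L k) - (real M + 1) powr (- \<alpha>) * C"
    by simp
  also have "\<dots> = (\<integral>a. ?U a + (\<Sum>k<Suc M. ?l a k) - (real M + 1) powr (- \<alpha>) * C
      \<partial>action_process (\<lambda>_. p))"
    unfolding total_utility_def
    using integrable_sum_stage_utility[OF p] prob_space
    by (simp add: expectation_action_indicator Bochner_Integration.integrable_sum
        del: sum.lessThan_Suc)
  also have "\<dots> \<le> (\<integral>a. ?U (\<lambda>k. f k (a k)) \<partial>action_process (\<lambda>_. p))"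
  proof (rule integral_mono_AE[OF _ int_f])
    show "integrable (action_process (\<lambda>_. p))
        (\<lambda>a. ?U a + (\<Sum>k<Suc M. ?l a k) - (real M + 1) powr (- \<alpha>) * C)"
      by (intro Bochner_Integration.integrable_diff Bochner_Integration.integrable_add
          integrable_sum_stage_utility p Bochner_Integration.integrable_sum
          expectation_action_indicator integrable_const)
    show "AE a in action_process (\<lambda>_. p).
        ?U a + (\<Sum>k<Suc M. ?l a k) - (real M + 1) powr (- \<alpha>) * C \<le> ?U (\<lambda>k. f k (a k))"
      using AE_action_process[OF p]
    proof eventually_elim
      case (elim a)
      then show ?case
        using suminf_stage_utility_switch[of a i j M "Suc M", folded d_def] \<open>i \<in> A\<close> j min_sojourn(1)
        by (simp add: f_def C_def powr_mult mult_ac del: sum.lessThan_Suc)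
    qed
  qed
  also have "\<dots> = total_utility \<alpha> r \<tau> \<sigma>"
    unfolding total_utility_def by (subst distr) (rule integral_distr[OF meas_f meas_U, symmetric])
  finally have "total_utility \<alpha> r \<tau> (\<lambda>_. p) < total_utility \<alpha> r \<tau> \<sigma>" .
  moreover have "total_utility \<alpha> r \<tau> \<sigma> \<le> total_utility \<alpha> r \<tau> (\<lambda>_. p)"
    using opt strong \<sigma> by (simp add: optimal_strategy_def)
  ultimately show False by simp
qed

end

lemma stationary_optimal_max_rate:
  "optimal_strategy A \<alpha> r \<tau> (\<lambda>_. p) \<Longrightarrow> i \<in> set_pmf p \<Longrightarrow> r i = max_rate * \<tau> i"
  using stationary_optimal_weak stationary_optimal_strong by (cases "\<alpha> > 1") auto

end


subsection \<open>The price of anarchy\<close>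

lemma action_data_game:
  assumes "power_law_game G" "\<mu> \<in> mass_distributions (actions G) (mass G)"
  shows "action_data (actions G) (reward G) (\<lambda>i. sojourn G i \<mu>) (exponent G)"
  using assms
  by unfold_locales (auto simp: power_law_game_def actions_def all_mass_distributions_def)

text \<open>Every action carrying mass is played, hence earns the maximal reward per unit of time,
  so each unit of mass contributes \<rho> to welfare.\<close>

lemma stationary_equilibrium_max_rate:
  assumes G: "power_law_game G" and eq: "\<mu> \<in> stationary_equilibria G"
  obtains \<rho> where "\<rho> > 0" "social_welfare G \<mu> = \<rho> * mass G"
    "\<And>i. i \<in> actions G \<Longrightarrow> reward G i \<le> \<rho> * sojourn G i \<mu>"
proof -
  obtain p \<theta> where \<mu>: "\<mu> \<in> mass_distributions (actions G) (mass G)"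
    and p: "set_pmf p \<subseteq> actions G"
    and \<theta>: "\<And>i. i \<in> actions G \<Longrightarrow> \<mu> i = \<theta> * pmf p i * sojourn G i \<mu>"
    and opt: "optimal_strategy (actions G) (exponent G) (reward G) (\<lambda>i. sojourn G i \<mu>) (\<lambda>k. p)"
    using eq by (auto simp: stationary_equilibria_def)
  interpret action_data "actions G" "reward G" "\<lambda>i. sojourn G i \<mu>" "exponent G"
    using G \<mu> by (rule action_data_game)
  have "reward G i * action_rate G i \<mu> = max_rate * \<mu> i" if i: "i \<in> actions G" for i
  proof (cases "i \<in> set_pmf p")
    case True
    with stationary_optimal_max_rate[OF opt] sojourn_pos[OF i] show ?thesis
      by (simp add: action_rate_def)
  next
    case False
    with \<theta>[OF i] show ?thesis by (simp add: action_rate_def set_pmf_iff)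
  qed
  then have "social_welfare G \<mu> = (\<Sum>i\<in>actions G. max_rate * \<mu> i)"
    unfolding social_welfare_def by (intro sum.cong) auto
  also have "\<dots> = max_rate * mass G"
    using \<mu> by (simp add: mass_distributions_def flip: sum_distrib_left)
  finally show ?thesis
    using that max_rate by blast
qed

text \<open>
  An action performed at a higher rate than in equilibrium has a longer sojourn time, so its reward
  per unit of time is at most the equilibrium value \<open>\<rho>\<close>; the remaining actions together yield at
  most the equilibrium welfare.
\<close>

lemma social_welfare_le_twice_equilibrium:
  assumes G: "power_law_game G" "rate_monotonous G"
    and eq: "\<mu> \<in> stationary_equilibria G"
    and \<nu>: "\<nu> \<in> mass_distributions (actions G) m" "0 < m" "m \<le> mass G"
  shows "social_welfare G \<nu> \<le> 2 * social_welfare G \<mu>"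
proof -
  obtain \<rho> where \<rho>: "\<rho> > 0" "social_welfare G \<mu> = \<rho> * mass G"
    "\<And>i. i \<in> actions G \<Longrightarrow> reward G i \<le> \<rho> * sojourn G i \<mu>"
    using stationary_equilibrium_max_rate[OF G(1) eq] by blast
  have \<mu>: "\<mu> \<in> mass_distributions (actions G) (mass G)"
    using eq by (auto simp: stationary_equilibria_def)
  have all: "\<mu> \<in> all_mass_distributions (actions G)" "\<nu> \<in> all_mass_distributions (actions G)"
    using G(1) \<mu> \<nu> by (auto simp: all_mass_distributions_def power_law_game_def)
  have le: "reward G i * action_rate G i \<nu> \<le> reward G i * action_rate G i \<mu> + \<rho> * \<nu> i"
    if i: "i \<in> actions G" for i
  proof -
    have pos: "reward G i > 0" "sojourn G i \<mu> > 0" "sojourn G i \<nu> > 0" "\<mu> i \<ge> 0" "\<nu> i \<ge> 0"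
      using G(1) all \<mu> \<nu> i by (auto simp: power_law_game_def mass_distributions_def)
    show ?thesis
    proof (cases "action_rate G i \<nu> \<le> action_rate G i \<mu>")
      case True
      with pos \<rho>(1) show ?thesis
        by (intro add_increasing2 mult_left_mono) auto
    next
      case False
      then have "sojourn G i \<mu> \<le> sojourn G i \<nu>"
        using G(2) all i by (auto simp: rate_monotonous_def)
      then have "reward G i \<le> \<rho> * sojourn G i \<nu>"
        using \<rho>(1) by (intro order_trans[OF \<rho>(3)[OF i]] mult_left_mono) auto
      then have "reward G i * \<nu> i \<le> \<rho> * sojourn G i \<nu> * \<nu> i"
        using pos by (intro mult_right_mono) auto
      then have "reward G i * action_rate G i \<nu> \<le> \<rho> * \<nu> i"
        using pos by (simp add: action_rate_def pos_divide_le_eq mult_ac)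
      moreover have "reward G i * action_rate G i \<mu> \<ge> 0"
        using pos by (simp add: action_rate_def)
      ultimately show ?thesis by simp
    qed
  qed
  have "social_welfare G \<nu> \<le> social_welfare G \<mu> + \<rho> * (\<Sum>i\<in>actions G. \<nu> i)"
    unfolding social_welfare_def sum_distrib_left sum.distrib[symmetric]
    by (intro sum_mono le)
  also have "\<dots> = social_welfare G \<mu> + \<rho> * m"
    using \<nu> by (simp add: mass_distributions_def)
  \<comment> \<open>As \<open>m\<close> is at most the total mass, the extra term is at most a
    second copy of the equilibrium welfare.\<close>
  also have "\<dots> \<le> 2 * social_welfare G \<mu>"
    using \<rho> \<nu> by simp
  finally show ?thesis .
qed

section \<open>Lower bound: games with ratio approaching 2\<close>

text \<open>
  Action \<open>1\<close> has capacity \<open>c\<close>: its rate is \<open>min \<mu>\<^sub>1 c\<close>. All mass on action \<open>1\<close> is an equilibrium of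
  welfare \<open>1\<close>, but mass \<open>c\<close> already extracts this welfare and leaves \<open>1 - c\<close> for action \<open>2\<close>.
\<close>

definition capacity_game :: "real \<Rightarrow> game" where
  "capacity_game c = \<lparr>mass = 1, num_actions = 2,
     reward = (\<lambda>i. if i = 1 then 1 / c else 1),
     sojourn = (\<lambda>i \<mu>. if i = 1 then max 1 (\<mu> 1 / c) else 1),
     exponent = 0\<rparr>"

lemma capacity_game_simps [simp]:
  "mass (capacity_game c) = 1" "num_actions (capacity_game c) = 2"
  "actions (capacity_game c) = {1, 2}" "exponent (capacity_game c) = 0"
  "reward (capacity_game c) i = (if i = 1 then 1 / c else 1)"
  "sojourn (capacity_game c) i = (\<lambda>\<mu>. if i = 1 then max 1 (\<mu> 1 / c) else 1)"
  by (auto simp: capacity_game_def actions_def)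

lemma mass_distributions_two:
  "\<mu> \<in> mass_distributions {1, 2} s \<longleftrightarrow>
     \<mu> \<in> extensional {1, 2} \<and> \<mu> 1 \<ge> 0 \<and> \<mu> 2 \<ge> 0 \<and> \<mu> 1 + \<mu> 2 = s"
  by (auto simp: mass_distributions_def PiE_iff)

context
  fixes c :: real
  assumes c: "0 < c" "c < 1"
begin

lemma action_rate_capacity_game:
  "action_rate (capacity_game c) i \<mu> = (if i = 1 then min (\<mu> 1) c else \<mu> i)"
  using c by (auto simp: action_rate_def max_def min_def divide_simps)

lemma social_welfare_capacity_game:
  "social_welfare (capacity_game c) \<mu> = min (\<mu> 1) c / c + \<mu> 2"
  by (simp add: social_welfare_def action_rate_capacity_game)

lemma power_law_capacity_game: "power_law_game (capacity_game c)"
  using c by (auto simp: power_law_game_def)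

lemma continuous_capacity_game: "continuous_sojourn (capacity_game c)"
proof -
  have "continuous_on S (\<lambda>\<mu> :: nat \<Rightarrow> real. \<mu> 1)" for S
    by (rule continuous_on_product_then_coordinatewise[OF continuous_on_id])
  then have "continuous_on S (\<lambda>\<mu> :: nat \<Rightarrow> real. max 1 (\<mu> 1 / c))" for S
    using c by (intro continuous_intros) auto
  then show ?thesis
    by (simp add: continuous_sojourn_def)
qed

text \<open>If the rate of action 1 can be exceeded, it is below capacity, where the sojourn time
  takes its least value 1.\<close>

lemma rate_monotonous_capacity_game: "rate_monotonous (capacity_game c)"
proof -
  have "max 1 (\<mu> 1 / c) \<le> max 1 (\<mu>' 1 / c)"
    if "min (\<mu> 1) c < min (\<mu>' 1) c" for \<mu> \<mu>' :: "nat \<Rightarrow> real"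
  proof -
    have "\<mu> 1 \<le> c"
      using that by (simp add: min_def split: if_splits)
    then have "\<mu> 1 / c \<le> 1"
      using c by simp
    then show ?thesis by (simp only: max_absorb1 max.cobounded1)
  qed
  then show ?thesis
    unfolding rate_monotonous_def action_rate_capacity_game by simp
qed

text \<open>Congestion raises the sojourn time of action 1 to \<open>1 / c\<close>, so both actions
  earn exactly 1 per unit of time and staying on action 1 is optimal. The normalizing constant is
  the reciprocal \<open>c\<close> of that sojourn time.\<close>

lemma stationary_equilibrium_capacity_game:
  "(\<lambda>i\<in>{1, 2}. if i = 1 then 1 else 0) \<in> stationary_equilibria (capacity_game c)" (is "?\<mu> \<in> _")
proof -
  have \<mu>: "?\<mu> \<in> mass_distributions (actions (capacity_game c)) (mass (capacity_game c))"
    by (simp add: mass_distributions_two del: One_nat_def)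
  interpret action_data "actions (capacity_game c)" "reward (capacity_game c)"
    "\<lambda>i. sojourn (capacity_game c) i ?\<mu>" "exponent (capacity_game c)"
    using power_law_capacity_game \<mu> by (rule action_data_game)
  have "max_rate = 1"
    unfolding max_rate_def using c by (simp add: max_def)
  with c have "optimal_strategy (actions (capacity_game c)) (exponent (capacity_game c))
      (reward (capacity_game c)) (\<lambda>i. sojourn (capacity_game c) i ?\<mu>) (\<lambda>_. return_pmf 1)"
    by (intro optimal_const) (auto simp: max_def)
  moreover have "\<forall>i\<in>actions (capacity_game c).
      ?\<mu> i = c * pmf (return_pmf 1) i * sojourn (capacity_game c) i ?\<mu>"
    using c by (auto simp: max_def)
  ultimately show ?thesis
    using \<mu> unfolding stationary_equilibria_def
    by (intro CollectI conjI exI[of _ "return_pmf 1"] exI[of _ c]) auto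
qed

lemma social_optimum_capacity_game:
  "(\<lambda>i\<in>{1, 2}. if i = 1 then c else 1 - c) \<in> social_optima (capacity_game c)" (is "?\<mu> \<in> _")
proof -
  have "min (\<nu> 1) c / c + \<nu> 2 \<le> 2 - c"
    if "\<nu> 1 + \<nu> 2 \<le> 1" for \<nu> :: "nat \<Rightarrow> real"
  proof (cases "\<nu> 1 \<le> c")
    case True
    \<comment> \<open>Below capacity, moving mass from action 2 to action 1 gains
      \<open>1 / c - 1\<close> per unit.\<close>
    have "(1 / c - 1) * \<nu> 1 \<le> (1 / c - 1) * c"
      using True c by (intro mult_left_mono) auto
    then have "\<nu> 1 / c - \<nu> 1 \<le> 1 - c"
      using c by (simp add: algebra_simps)
    with True that show ?thesis by simp
  next
    \<comment> \<open>Above capacity action 1 yields exactly 1, and less than \<open>1 - c\<close>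
      remains for action 2.\<close>
    case False
    with c that show ?thesis by simp
  qed
  moreover have "?\<mu> \<in> mass_distributions {1, 2} 1"
    using c by (simp add: mass_distributions_two del: One_nat_def)
  moreover have "min (?\<mu> 1) c / c + ?\<mu> 2 = 2 - c"
    using c by simp
  moreover have "\<nu> 1 + \<nu> 2 \<le> 1" if "\<nu> \<in> mass_distributions {1, 2} m" "m \<le> 1" for \<nu> m
    using that by (simp add: mass_distributions_two del: One_nat_def)
  ultimately show ?thesis
    unfolding social_optima_def is_arg_max_linorder social_welfare_capacity_game
      capacity_game_simps
    by fastforce
qed

end

theorem proposition5:
  "Sup {ereal (social_welfare G \<mu>opt / social_welfare G \<mu>eq) | G \<mu>opt \<mu>eq.
          power_law_game G \<and> continuous_sojourn G \<and> rate_monotonous G \<and>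
          stationary_equilibria G \<noteq> {} \<and>
          \<mu>opt \<in> social_optima G \<and> \<mu>eq \<in> stationary_equilibria G} = 2"
  (is "Sup ?R = 2")
proof (rule antisym)
  show "Sup ?R \<le> 2"
  proof (rule Sup_least)
    fix x assume "x \<in> ?R"
    then obtain G \<nu> \<mu> where x: "x = ereal (social_welfare G \<nu> / social_welfare G \<mu>)"
      and G: "power_law_game G" "rate_monotonous G"
      and \<nu>: "\<nu> \<in> social_optima G" and \<mu>: "\<mu> \<in> stationary_equilibria G"
      by blast
    obtain m where "\<nu> \<in> mass_distributions (actions G) m" "0 < m" "m \<le> mass G"
      using \<nu> by (auto simp: social_optima_def is_arg_max_def)
    then have "social_welfare G \<nu> \<le> 2 * social_welfare G \<mu>"
      using social_welfare_le_twice_equilibrium[OF G \<mu>] by blast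
    \<comment> \<open>Positivity rules out the default value of division by zero and lets the
      welfare inequality be divided.\<close>
    moreover have "social_welfare G \<mu> > 0"
    proof -
      obtain \<rho> where "\<rho> > 0" "social_welfare G \<mu> = \<rho> * mass G"
        using stationary_equilibrium_max_rate[OF G(1) \<mu>] by blast
      with G(1) show ?thesis by (simp add: power_law_game_def)
    qed
    ultimately have "social_welfare G \<nu> / social_welfare G \<mu> \<le> 2"
      by (simp add: pos_divide_le_eq)
    then show "x \<le> 2" by (simp add: x)
  qed
next
  have lower: "ereal (2 - c) \<le> Sup ?R" if c: "0 < c" "c < 1" for c
  proof (rule Sup_upper)
    let ?opt = "\<lambda>i\<in>{1, 2}. if i = 1 then c else 1 - c"
    let ?eq = "\<lambda>i\<in>{1, 2 :: nat}. if i = 1 then 1 else 0 :: real"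
    have "2 - c = social_welfare (capacity_game c) ?opt / social_welfare (capacity_game c) ?eq"
      using c by (simp add: social_welfare_capacity_game)
    then show "ereal (2 - c) \<in> ?R"
      using power_law_capacity_game[OF c] continuous_capacity_game[OF c]
        rate_monotonous_capacity_game[OF c] social_optimum_capacity_game[OF c]
        stationary_equilibrium_capacity_game[OF c]
      by blast
  qed
  \<comment> \<open>The ratios \<open>2 - c\<close> stay below 2, so a limit is taken along
    \<open>c = 1 / (n + 2)\<close>; the shift by two keeps \<open>c\<close> strictly below
    1.\<close>
  have "(\<lambda>n. ereal (2 - 1 / real (Suc (Suc n)))) \<longlonglongrightarrow> ereal (2 - 0)"
    by (intro tendsto_intros lim_1_over_n[THEN LIMSEQ_Suc, THEN LIMSEQ_Suc])
  then have "ereal (2 - 0) \<le> Sup ?R"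
  proof (rule LIMSEQ_le_const2, intro exI allI impI)
    show "ereal (2 - 1 / real (Suc (Suc n))) \<le> Sup ?R" for n
      by (rule lower) auto
  qed
  moreover have "ereal (2 - 0) = 2" by simp
  ultimately show "2 \<le> Sup ?R" by (simp only:)
qed

end
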